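(* A graph class $\mathcal{G}$ has bounded expansion if and only if there exists a function $c^*:\mathbb{N}\to\mathbb{N}$ such that for every graph $G\in\mathcal{G}$ there exists an ordering $\sigma^*(G)$ of $G$ such that $\operatorname{scol}_r(G,\sigma^*(G))\le c^*(r)$ for all $r\in\mathbb{N}$.
   Context: All graphs $G=(V,E)$ are finite, simple and undirected. $\mathbb{N}$ denotes the positive integers. An ordering $\sigma$ of $G$ is a total ordering $<_\sigma$ of its vertex set $V$; $\Pi(G)$ denotes the set of all orderings of $G$. For $r\in\mathbb{N}$, $\sigma\in\Pi(G)$ and $x\in V$, a vertex $y$ is strongly $r$-reachable from $x$ with respect to $\sigma$ if $y\le_\sigma x$ and there is a path $P$ in $G$ from $x$ to $y$ with at most $r$ edges such that every vertex $p\in V(P)\setminus\{y\}$ satisfies $p\ge_\sigma x$. Let $S_r[G,\sigma,x]$ be the set of vertices strongly $r$-reachable from $x$ (it contains $x$ itself). Define $\operatorname{scol}_r(G,\sigma)=\max_{x\in V}|S_r[G,\sigma,x]|$ and $\operatorname{scol}_r(G)=\min_{\sigma\in\Pi(G)}\operatorname{scol}_r(G,\sigma)$. Definition of bounded expansion used here: a graph class $\mathcal{G}$ has bounded expansion if and only if there exists a function $c:\mathbb{N}\to\mathbb{N}$ such that $\operatorname{scol}_r(G)\le c(r)$ for all $r\in\mathbb{N}$ and all $G\in\mathcal{G}$. *)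

theory Defs
  imports "Graph_Theory.Pair_Digraph"
begin

text \<open>
  A finite simple undirected graph is a \<^locale>\<open>pair_graph\<close>: each edge is represented
  by its two opposite arcs, so the number of edges of a path is the length of its arc list.
\<close>

text \<open>An ordering \<open>\<sigma>\<close> is a reflexive linear order; \<open>(y, x) \<in> \<sigma>\<close> means that \<open>y\<close> is at most \<open>x\<close>.\<close>

definition orderings :: "'a pair_pre_digraph \<Rightarrow> 'a rel set" where
  "orderings G = {\<sigma>. linear_order_on (pverts G) \<sigma>}"

definition strongly_reachable ::
    "nat \<Rightarrow> 'a pair_pre_digraph \<Rightarrow> 'a rel \<Rightarrow> 'a \<Rightarrow> 'a \<Rightarrow> bool" where
  "strongly_reachable r G \<sigma> x y \<longleftrightarrow>
     (y, x) \<in> \<sigma> \<and>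
     (\<exists>P. pre_digraph.apath (with_proj G) x P y \<and> length P \<le> r \<and>
          (\<forall>p \<in> set (pre_digraph.awalk_verts (with_proj G) x P) - {y}. (x, p) \<in> \<sigma>))"

definition S_reach :: "nat \<Rightarrow> 'a pair_pre_digraph \<Rightarrow> 'a rel \<Rightarrow> 'a \<Rightarrow> 'a set" where
  "S_reach r G \<sigma> x = {y \<in> pverts G. strongly_reachable r G \<sigma> x y}"

text \<open>The maximum over the empty vertex set is taken to be 0.\<close>

definition scol_ord :: "nat \<Rightarrow> 'a pair_pre_digraph \<Rightarrow> 'a rel \<Rightarrow> nat" where
  "scol_ord r G \<sigma> =
     (if pverts G = {} then 0 else Max ((\<lambda>x. card (S_reach r G \<sigma> x)) ` pverts G))"

definition scol :: "nat \<Rightarrow> 'a pair_pre_digraph \<Rightarrow> nat" where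
  "scol r G = Min (scol_ord r G ` orderings G)"

text \<open>The parameter \<open>r\<close> and the bounds range over the positive integers.\<close>

definition bounded_expansion :: "'a pair_pre_digraph set \<Rightarrow> bool" where
  "bounded_expansion \<G> \<longleftrightarrow>
     (\<exists>c :: nat \<Rightarrow> nat. (\<forall>r\<ge>1. c r \<ge> 1) \<and> (\<forall>r\<ge>1. \<forall>G\<in>\<G>. scol r G \<le> c r))"

end

theory Submission
  imports Defs
begin

text \<open>
  Call a set of walks that start at \<open>x\<close>, end in a vertex set \<open>U\<close>, have length at most \<open>r\<close> and
  meet only in \<open>x\<close> an \<open>r\<close>-fan from \<open>x\<close> to \<open>U\<close>. Let \<open>\<sigma>\<close> be an ordering with
  \<open>scol\<^sub>r(G, \<sigma>) \<le> s\<close>. The \<open>\<sigma>\<close>-least vertex of a walk of length at most \<open>r\<close> is reached from either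
  end by \<open>r\<close> strong reachability steps, so it lies in a set of size at most \<open>s^r\<close> attached to each
  end. Charging each walk of a fan to its least vertex shows that the sizes of arbitrary \<open>r\<close>-fans,
  one from each \<open>x \<in> U\<close> to \<open>U\<close>, sum to at most \<open>2 s^r |U|\<close>. Hence at most \<open>|U| / 2^r\<close>
  vertices have an \<open>r\<close>-fan larger than \<open>2^(r+1) s^r\<close>. No fan has more than \<open>|U|\<close> walks, so
  this happens for finitely many \<open>r \<ge> 1\<close> only; their \<open>2^(-r)\<close> sum to less than 1, and some
  vertex of \<open>U\<close> has only small fans for all \<open>r\<close> simultaneously. Repeatedly removing such a
  vertex from \<open>V\<close> and placing it last gives the uniform ordering. In this ordering the number of
  vertices strongly \<open>r\<close>-reachable from \<open>x\<close> is bounded, because in a breadth-first tree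
  of paths that witness reachability the subtrees below a vertex \<open>v\<close> contain a fan from \<open>v\<close> to the
  vertices that precede \<open>v\<close>.
\<close>

text \<open>A walk of a fan is stored as the list of its vertices after \<open>x\<close>.\<close>

definition fan :: "'a pair_pre_digraph \<Rightarrow> nat \<Rightarrow> 'a set \<Rightarrow> 'a \<Rightarrow> 'a list set \<Rightarrow> bool" where
  "fan G r U x F \<longleftrightarrow>
     (\<forall>P\<in>F. P \<noteq> [] \<and> length P \<le> r \<and> successively (\<lambda>u v. (u, v) \<in> parcs G) (x # P) \<and> last P \<in> U) \<and>
     (\<forall>P\<in>F. \<forall>Q\<in>F. P \<noteq> Q \<longrightarrow> set P \<inter> set Q = {})"

fun iter_reach :: "('a \<Rightarrow> 'a set) \<Rightarrow> nat \<Rightarrow> 'a \<Rightarrow> 'a set" where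
  "iter_reach S 0 x = {x}"
| "iter_reach S (Suc n) x = (\<Union>z\<in>S x. iter_reach S n z)"

section \<open>Walks as vertex lists, and strong reachability\<close>

context pair_graph
begin

lemma walk_imp_awalk:
  assumes "x \<in> pverts G" "successively (\<lambda>u v. (u, v) \<in> parcs G) (x # xs)"
  shows "\<exists>p. awalk x p (last (x # xs)) \<and> pawalk_verts x p = x # xs \<and> length p = length xs"
  using assms
proof (induction xs arbitrary: x)
  case Nil
  then show ?case by (intro exI[of _ "[]"]) (auto simp: awalk_Nil_iff)
next
  case (Cons y ys)
  then have e: "(x, y) \<in> parcs G" and y: "y \<in> pverts G"
    and s: "successively (\<lambda>u v. (u, v) \<in> parcs G) (y # ys)"
    by (auto intro: wellformed')
  from Cons.IH[OF y s] obtain p where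
    "awalk y p (last (y # ys))" "pawalk_verts y p = y # ys" "length p = length ys" by blast
  with e show ?case by (intro exI[of _ "(x, y) # p"]) (auto simp: awalk_Cons_iff)
qed

lemma awalk_imp_walk:
  assumes "awalk x p y"
  shows "successively (\<lambda>u v. (u, v) \<in> parcs G) (pawalk_verts x p)"
  using assms
proof (induction p arbitrary: x)
  case (Cons e es)
  then have "successively (\<lambda>u v. (u, v) \<in> parcs G) (pawalk_verts (snd e) es)"
    and "e \<in> parcs G" by (auto simp: awalk_Cons_iff)
  then show ?case by (cases es) (use Cons.prems in \<open>auto simp: awalk_Cons_iff\<close>)
qed simp

text \<open>A walk is enough as a witness: shortening it to a path only discards arcs, so the length
  does not grow and no new vertex has to be compared with \<open>x\<close>.\<close>

lemma S_reachI:
  assumes "x \<in> pverts G" "successively (\<lambda>u v. (u, v) \<in> parcs G) (x # xs)"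
    and "length xs \<le> r" "y = last (x # xs)" "(y, x) \<in> \<sigma>"
    and "\<And>p. p \<in> set (x # xs) \<Longrightarrow> p \<noteq> y \<Longrightarrow> (x, p) \<in> \<sigma>"
  shows "y \<in> S_reach r G \<sigma> x"
proof -
  obtain p where p: "awalk x p y" "pawalk_verts x p = x # xs" "length p = length xs"
    using walk_imp_awalk[OF assms(1,2)] assms(4) by auto
  let ?q = "awalk_to_apath p"
  have q: "apath x ?q y" using apath_awalk_to_apath[OF p(1)] .
  then have aw: "awalk x ?q y" and d: "distinct (pawalk_verts x ?q)"
    by (auto simp: apath_def)
  have sub: "set ?q \<subseteq> set p" using awalk_to_apath_subset[OF p(1)] .
  have "length ?q = card (set ?q)"
    using distinct_card[OF distinct_verts_imp_distinct[OF aw d]] by simp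
  also have "\<dots> \<le> card (set p)" using sub by (intro card_mono) auto
  also have "\<dots> \<le> length p" by (rule card_length)
  finally have len: "length ?q \<le> r" using p(3) assms(3) by simp
  have "set (pawalk_verts x ?q) \<subseteq> set (pawalk_verts x p)"
    using set_awalk_verts[OF aw] set_awalk_verts[OF p(1)] sub by auto
  then have "set (pawalk_verts x ?q) \<subseteq> set (x # xs)" using p(2) by simp
  moreover have "y \<in> pverts G" using awalk_last_in_verts[OF p(1)] .
  ultimately show ?thesis unfolding S_reach_def strongly_reachable_def
    using q len assms(5,6) by (auto 4 4)
qed

text \<open>A path visits its end \<open>y\<close> only once, so the exemption of \<open>y\<close>
  becomes the restriction to \<open>butlast\<close>.\<close>

lemma S_reachE:
  assumes "y \<in> S_reach r G \<sigma> x"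
  obtains xs where "successively (\<lambda>u v. (u, v) \<in> parcs G) (x # xs)" "length xs \<le> r"
    "last (x # xs) = y" "\<And>p. p \<in> set (butlast (x # xs)) \<Longrightarrow> (x, p) \<in> \<sigma>" "(y, x) \<in> \<sigma>"
proof -
  from assms obtain P where P: "apath x P y" "length P \<le> r" "(y, x) \<in> \<sigma>"
    "\<And>p. p \<in> set (pawalk_verts x P) \<Longrightarrow> p \<noteq> y \<Longrightarrow> (x, p) \<in> \<sigma>"
    unfolding S_reach_def strongly_reachable_def by auto
  from P(1) have aw: "awalk x P y" and d: "distinct (pawalk_verts x P)" by (auto simp: apath_def)
  obtain xs where xs: "pawalk_verts x P = x # xs"
    using aw by (cases P) (auto simp: awalk_Cons_iff)
  have last: "last (x # xs) = y" using awlast_of_awalk[OF aw] xs by simp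
  have "length (pawalk_verts x P) = Suc (length P)" by (rule length_awalk_verts)
  moreover have "y \<notin> set (butlast (x # xs))"
    using d xs last append_butlast_last_id[of "x # xs"]
    by (metis distinct_append disjoint_iff list.distinct(1) list.set_intros(1))
  ultimately show thesis
    using that[of xs] awalk_imp_walk[OF aw] xs P last in_set_butlastD[of _ "x # xs"] by (metis length_Cons nat.inject)
qed

lemma walk_in_pverts:
  assumes "x \<in> pverts G" "successively (\<lambda>u v. (u, v) \<in> parcs G) (x # xs)"
  shows "set (x # xs) \<subseteq> pverts G"
  using walk_imp_awalk[OF assms] by (metis awalkE')

end

section \<open>Iterated strong reachability\<close>

lemma iter_reach_self:
  assumes "\<And>x. x \<in> V \<Longrightarrow> x \<in> S x" "x \<in> V"
  shows "x \<in> iter_reach S n x"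
  using assms by (induction n) auto

lemma iter_reach_subset:
  assumes "\<And>x. x \<in> V \<Longrightarrow> S x \<subseteq> V" "x \<in> V"
  shows "iter_reach S n x \<subseteq> V"
  using assms(2)
proof (induction n arbitrary: x)
  case (Suc n)
  then show ?case using assms(1) by fastforce
qed simp

lemma card_iter_reach_le:
  assumes "finite V" "\<And>x. x \<in> V \<Longrightarrow> S x \<subseteq> V" "\<And>x. x \<in> V \<Longrightarrow> card (S x) \<le> s" "x \<in> V"
  shows "card (iter_reach S n x) \<le> s ^ n"
  using assms(4)
proof (induction n arbitrary: x)
  case (Suc n)
  have "card (iter_reach S (Suc n) x) \<le> (\<Sum>z\<in>S x. card (iter_reach S n z))"
    using finite_subset[OF assms(2)[OF Suc.prems] assms(1)] by (simp add: card_UN_le)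
  also have "\<dots> \<le> (\<Sum>z\<in>S x. s ^ n)"
    using Suc assms(2) by (intro sum_mono) blast
  also have "\<dots> \<le> s ^ Suc n" using assms(3)[OF Suc.prems] by simp
  finally show ?case .
qed simp

context pair_graph
begin

text \<open>From \<open>x\<close> jump to the first vertex \<open>z\<close> of the walk strictly
  below \<open>x\<close>: no vertex before it is below \<open>x\<close>, so the initial segment
  witnesses strong reachability. The rest is shorter and still ends in its minimum \<open>m\<close>.
  Only the number of steps \<open>n\<close> shrinks; the radius \<open>r\<close> of each step stays
  fixed.\<close>

lemma walk_min_in_iter_reach:
  assumes lin: "linear_order_on (pverts G) \<sigma>"
    and "x \<in> pverts G" "successively (\<lambda>u v. (u, v) \<in> parcs G) (x # xs)"
    and "length xs \<le> n" "n \<le> r" "m = last (x # xs)" "\<And>p. p \<in> set (x # xs) \<Longrightarrow> (m, p) \<in> \<sigma>"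
  shows "m \<in> iter_reach (S_reach r G \<sigma>) n x"
  using assms(2-)
proof (induction n arbitrary: x xs)
  case 0
  then show ?case by simp
next
  case (Suc n)
  have refl: "(v, v) \<in> \<sigma>" if "v \<in> pverts G" for v
    using lin that by (auto simp: order_on_defs refl_on_def)
  have anti: "u = v" if "(u, v) \<in> \<sigma>" "(v, u) \<in> \<sigma>" for u v
    using lin that by (auto simp: order_on_defs antisym_def)
  have total: "(x, v) \<in> \<sigma>" if "(v, x) \<notin> \<sigma>" "v \<in> pverts G" for v
    using lin that refl Suc.prems(1) by (cases "v = x") (auto simp: order_on_defs total_on_def)
  have self: "v \<in> S_reach r G \<sigma> v" if "v \<in> pverts G" for v
    using that refl by (intro S_reachI[of _ "[]"]) auto
  have xsV: "set (x # xs) \<subseteq> pverts G" by (rule walk_in_pverts[OF Suc.prems(1,2)])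
  show ?case
  proof (cases "\<exists>z\<in>set xs. z \<noteq> x \<and> (z, x) \<in> \<sigma>")
    case False
    have "m = x"
    proof (rule ccontr)
      assume "m \<noteq> x"
      then have "m \<in> set xs" using Suc.prems(5) by (metis last_ConsL last_ConsR last_in_set)
      with False \<open>m \<noteq> x\<close> Suc.prems(6)[of x] show False by auto
    qed
    then show ?thesis using iter_reach_self[OF self Suc.prems(1)] by blast
  next
    case True
    then obtain ys z zs where xs: "xs = ys @ z # zs" and z: "z \<noteq> x" "(z, x) \<in> \<sigma>"
      and ys: "\<And>u. u \<in> set ys \<Longrightarrow> \<not> (u \<noteq> x \<and> (u, x) \<in> \<sigma>)"
      using split_list_first_prop[OF True] by blast
    have "successively (\<lambda>u v. (u, v) \<in> parcs G) ((x # ys @ [z]) @ zs)"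
      using Suc.prems(2) xs by simp
    then have s1: "successively (\<lambda>u v. (u, v) \<in> parcs G) (x # ys @ [z])"
      by (subst (asm) successively_append_iff) simp
    have "successively (\<lambda>u v. (u, v) \<in> parcs G) ((x # ys) @ (z # zs))"
      using Suc.prems(2) xs by simp
    then have s2: "successively (\<lambda>u v. (u, v) \<in> parcs G) (z # zs)"
      by (subst (asm) successively_append_iff) simp
    have "z \<in> S_reach r G \<sigma> x"
    proof (rule S_reachI[OF Suc.prems(1) s1])
      show "length (ys @ [z]) \<le> r" using Suc.prems(3,4) xs by simp
      fix p assume "p \<in> set (x # ys @ [z])" "p \<noteq> z"
      then show "(x, p) \<in> \<sigma>" using ys[of p] total[of p] refl[of x] xsV xs by auto
    qed (use z in auto)
    moreover have "m \<in> iter_reach (S_reach r G \<sigma>) n z"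
      by (rule Suc.IH[OF _ s2]) (use Suc.prems xs xsV in auto)
    ultimately show ?thesis by auto
  qed
qed

end

section \<open>Lists, minima, and orderings built from the last element\<close>

lemma successively_map_upt:
  assumes "\<And>j. m \<le> j \<Longrightarrow> Suc j < n \<Longrightarrow> P (f j) (f (Suc j))"
  shows "successively P (map f [m..<n])"
  using assms
proof (induction n)
  case (Suc n)
  have "successively P (map f [m..<n])" using Suc by simp
  moreover have "P (last (map f [m..<n])) (f n)" if "m < n"
    using that Suc.prems[of "n - 1"] by (simp add: last_map)
  ultimately show ?case by (cases "m < n") (auto simp: successively_append_iff)
qed simp

lemma linear_order_on_finite_min:
  assumes "linear_order_on V \<sigma>" "A \<subseteq> V" "finite A" "A \<noteq> {}"
  shows "\<exists>m\<in>A. \<forall>p\<in>A. (m, p) \<in> \<sigma>"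
  using assms(3,4,2)
proof (induction A rule: finite_ne_induct)
  case (singleton a)
  then show ?case using assms(1) by (auto simp: order_on_defs refl_on_def)
next
  case (insert a A)
  then obtain m where m: "m \<in> A" "\<forall>p\<in>A. (m, p) \<in> \<sigma>" by auto
  have aV: "a \<in> V" "m \<in> V" "a \<noteq> m" using insert.prems insert.hyps m(1) by auto
  have tr: "trans \<sigma>" and tot: "total_on V \<sigma>" and rf: "refl_on V \<sigma>"
    using assms(1) by (simp_all add: order_on_defs)
  have aa: "(a, a) \<in> \<sigma>" using rf aV(1) by (simp add: refl_on_def)
  from tot aV consider "(a, m) \<in> \<sigma>" | "(m, a) \<in> \<sigma>" unfolding total_on_def by blast
  then show ?case
  proof cases
    case 1
    then have "\<forall>p\<in>A. (a, p) \<in> \<sigma>" using m(2) transD[OF tr] by blast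
    then show ?thesis using aa by blast
  next
    case 2
    then show ?thesis using m by blast
  qed
qed

text \<open>A good vertex of the whole set goes last, where its predecessors are the whole set; the
  induction orders the rest.\<close>

lemma exists_ordering:
  assumes "finite V" "\<And>U. U \<subseteq> V \<Longrightarrow> U \<noteq> {} \<Longrightarrow> \<exists>x\<in>U. good U x"
  shows "\<exists>\<sigma>. linear_order_on V \<sigma> \<and> (\<forall>x\<in>V. good {y. (y, x) \<in> \<sigma>} x)"
  using assms
proof (induction V rule: finite_psubset_induct)
  case (psubset V)
  show ?case
  proof (cases "V = {}")
    case True
    then show ?thesis by (intro exI[of _ "{}"]) (auto simp: order_on_defs refl_on_def)
  next
    case False
    then obtain x where x: "x \<in> V" "good V x" using psubset.prems by blast
    then have "V - {x} \<subset> V" by blast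
    then have "\<exists>\<sigma>. linear_order_on (V - {x}) \<sigma> \<and> (\<forall>v\<in>V - {x}. good {y. (y, v) \<in> \<sigma>} v)"
      by (rule psubset.IH) (use psubset.prems in blast)
    then obtain \<sigma> where
      lin: "linear_order_on (V - {x}) \<sigma>" and g: "\<And>v. v \<in> V - {x} \<Longrightarrow> good {y. (y, v) \<in> \<sigma>} v"
      by blast
    have sub: "\<sigma> \<subseteq> (V - {x}) \<times> (V - {x})" using lin by (simp add: order_on_defs)
    define \<tau> where "\<tau> = \<sigma> \<union> V \<times> {x}"
    have "linear_order_on V \<tau>"
      unfolding linear_order_on_def partial_order_on_def preorder_on_def
    proof (intro conjI)
      show "\<tau> \<subseteq> V \<times> V" using sub x by (auto simp: \<tau>_def)
      show "refl_on V \<tau>" using lin by (auto simp: \<tau>_def order_on_defs refl_on_def)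
      show "trans \<tau>" using lin sub unfolding \<tau>_def order_on_defs trans_def by blast
      show "antisym \<tau>" using lin sub unfolding \<tau>_def order_on_defs antisym_def by blast
      show "total_on V \<tau>" using lin sub unfolding \<tau>_def order_on_defs total_on_def by blast
    qed
    \<comment> \<open>Only \<open>x\<close> gains predecessors, so goodness of the other vertices
      carries over.\<close>
    moreover have "good {y. (y, v) \<in> \<tau>} v" if "v \<in> V" for v
    proof (cases "v = x")
      case True
      have "{y. (y, x) \<in> \<tau>} = V" using sub by (auto simp: \<tau>_def)
      then show ?thesis using x True by simp
    next
      case False
      then have "{y. (y, v) \<in> \<tau>} = {y. (y, v) \<in> \<sigma>}" by (auto simp: \<tau>_def)
      then show ?thesis using g that False by simp
    qed
    ultimately show ?thesis by blast
  qed
qed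

section \<open>Fans and double counting\<close>

text \<open>Disjoint walks cannot share a chosen vertex. This turns a count of walks into a count of
  vertices, with \<open>f\<close> picking a marked vertex or the endpoint.\<close>

lemma fan_inj_on:
  assumes "fan G r U x F" "\<And>P. P \<in> F' \<Longrightarrow> f P \<in> set P" "F' \<subseteq> F"
  shows "inj_on f F'"
  using assms unfolding fan_def inj_on_def by (metis IntI empty_iff subsetD)

lemma card_fan_le:
  assumes "fan G r U x F" "finite U"
  shows "finite F" "card F \<le> card U"
proof -
  have i: "inj_on last F" by (rule fan_inj_on[OF assms(1)]) (use assms(1) in \<open>auto simp: fan_def\<close>)
  have s: "last ` F \<subseteq> U" using assms(1) by (auto simp: fan_def)
  show "finite F" using i s assms(2) by (metis finite_imageD finite_subset)
  show "card F \<le> card U" using card_inj_on_le[OF i s assms(2)] .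
qed

context pair_graph
begin

text \<open>At most \<open>s ^ r\<close> walks from \<open>x\<close> can meet \<open>W x\<close>;
  the others are counted by pairs \<open>x\<close>, \<open>y\<close> in \<open>U\<close> with
  \<open>x \<in> W y\<close>. Each kind contributes at most \<open>s ^ r * card U\<close> in total,
  hence the factor 2.\<close>

lemma sum_card_fans_le:
  assumes lin: "linear_order_on (pverts G) \<sigma>"
    and scol: "\<And>x. x \<in> pverts G \<Longrightarrow> card (S_reach r G \<sigma> x) \<le> s"
    and U: "U \<subseteq> pverts G"
    and fan: "\<And>x. x \<in> U \<Longrightarrow> fan G r U x (F x)"
  shows "(\<Sum>x\<in>U. card (F x)) \<le> 2 * s ^ r * card U"
proof -
  define W where "W = iter_reach (S_reach r G \<sigma>) r"
  have SV: "S_reach r G \<sigma> x \<subseteq> pverts G" for x by (auto simp: S_reach_def)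
  have finW: "finite (W x)" and cardW: "card (W x) \<le> s ^ r" if "x \<in> pverts G" for x
    using finite_subset[OF iter_reach_subset[OF SV that] pair_finite_verts]
      card_iter_reach_le[OF pair_finite_verts SV scol that] by (simp_all add: W_def)
  have finU: "finite U" using finite_subset[OF U pair_finite_verts] .
  have key: "card (F x) \<le> s ^ r + card {y\<in>U. x \<in> W y}" if x: "x \<in> U" for x
  proof -
    \<comment> \<open>The least vertex of \<open>x # P\<close> lies in \<open>P\<close> (\<open>?A\<close>; then it determines \<open>P\<close>, the walks being
      disjoint) or is \<open>x\<close> itself (\<open>?B\<close>; then \<open>P\<close> is charged to its endpoint).\<close>
    let ?A = "{P\<in>F x. \<exists>m\<in>set P. m \<in> W x}"
    let ?B = "{P\<in>F x. x \<in> W (last P)}"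
    have "F x \<subseteq> ?A \<union> ?B"
    proof
      fix P assume P: "P \<in> F x"
      then have s: "successively (\<lambda>u v. (u, v) \<in> parcs G) (x # P)" and ne: "P \<noteq> []"
        and len: "length P \<le> r" and lastU: "last P \<in> U"
        using fan[OF x] by (auto simp: fan_def)
      have xV: "x \<in> pverts G" using x U by auto
      have PV: "set (x # P) \<subseteq> pverts G" by (rule walk_in_pverts[OF xV s])
      from linear_order_on_finite_min[OF lin PV] obtain m where
        m: "m \<in> set (x # P)" "\<And>p. p \<in> set (x # P) \<Longrightarrow> (m, p) \<in> \<sigma>" by auto
      show "P \<in> ?A \<union> ?B"
      proof (cases "m \<in> set P")
        case True
        then obtain ys zs where P': "P = ys @ m # zs" by (metis split_list)
        have "successively (\<lambda>u v. (u, v) \<in> parcs G) ((x # ys @ [m]) @ zs)"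
          using s P' by simp
        then have s1: "successively (\<lambda>u v. (u, v) \<in> parcs G) (x # ys @ [m])"
          by (subst (asm) successively_append_iff) simp
        have "m \<in> W x" unfolding W_def
          by (rule walk_min_in_iter_reach[OF lin xV s1]) (use P' len m in auto)
        then show ?thesis using P True by auto
      next
        case False
        then have mx: "m = x" using m by auto
        \<comment> \<open>The minimum is now the start \<open>x\<close>, so the walk is read
          backwards from its endpoint; arcs come in opposite pairs.\<close>
        have rev: "rev (x # P) = last P # rev (x # butlast P)"
          using ne by (metis append_butlast_last_id butlast.simps(2) last_ConsR list.distinct(1) rev_eq_Cons_iff rev_rev_ident)
        have sym: "(u, v) \<in> parcs G \<longleftrightarrow> (v, u) \<in> parcs G" for u v
          using arcs_symmetric by blast
        have "successively (\<lambda>u v. (u, v) \<in> parcs G) (rev (x # P))"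
          unfolding successively_rev using s by (subst sym)
        then have s1: "successively (\<lambda>u v. (u, v) \<in> parcs G) (last P # rev (x # butlast P))"
          unfolding rev .
        have "x \<in> W (last P)" unfolding W_def
        proof (rule walk_min_in_iter_reach[OF lin _ s1])
          show "last P \<in> pverts G" using lastU U by auto
          show "length (rev (x # butlast P)) \<le> r" using len ne by simp
          fix p assume "p \<in> set (last P # rev (x # butlast P))"
          then have "p \<in> set (x # P)" unfolding rev[symmetric] by simp
          then show "(x, p) \<in> \<sigma>" using m(2) mx by blast
        qed (use ne in auto)
        then show ?thesis using P by auto
      qed
    qed
    moreover have "finite (F x)" using card_fan_le[OF fan[OF x] finU] by simp
    ultimately have "card (F x) \<le> card (?A \<union> ?B)" by (intro card_mono) auto
    also have "\<dots> \<le> card ?A + card ?B" by (rule card_Un_le)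
    finally have "card (F x) \<le> card ?A + card ?B" .
    moreover have "card ?A \<le> s ^ r"
    proof -
      have "\<forall>P\<in>?A. \<exists>m. m \<in> set P \<and> m \<in> W x" by blast
      from bchoice[OF this] obtain f where f: "\<And>P. P \<in> ?A \<Longrightarrow> f P \<in> set P \<and> f P \<in> W x" by blast
      have "inj_on f ?A" by (rule fan_inj_on[OF fan[OF x]]) (use f in blast)+
      moreover have "f ` ?A \<subseteq> W x" using f by blast
      ultimately have "card ?A \<le> card (W x)" using finW[of x] x U by (intro card_inj_on_le) auto
      then show ?thesis using cardW[of x] x U by auto
    qed
    moreover have "card ?B \<le> card {y\<in>U. x \<in> W y}"
    proof (rule card_inj_on_le)
      show "inj_on last ?B"
        by (rule fan_inj_on[OF fan[OF x]]) (use fan[OF x] in \<open>auto simp: fan_def\<close>)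
    qed (use fan[OF x] finU in \<open>auto simp: fan_def\<close>)
    ultimately show ?thesis by linarith
  qed
  \<comment> \<open>For a single \<open>x\<close> the number of \<open>y\<close> with
    \<open>x \<in> W y\<close> has no such bound; only the sum over \<open>x\<close> is controlled,
    by exchanging the order of summation.\<close>
  have "(\<Sum>x\<in>U. card {y\<in>U. x \<in> W y}) = (\<Sum>y\<in>U. card {x\<in>U. x \<in> W y})"
    using sum_multicount_gen[OF finU finU, of "\<lambda>x y. x \<in> W y" "\<lambda>y. card {x\<in>U. x \<in> W y}"] by simp
  also have "\<dots> \<le> (\<Sum>y\<in>U. s ^ r)"
  proof (rule sum_mono)
    fix y assume "y \<in> U"
    then have y: "y \<in> pverts G" using U by auto
    have "card {x\<in>U. x \<in> W y} \<le> card (W y)" using finW[OF y] by (intro card_mono) auto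
    then show "card {x\<in>U. x \<in> W y} \<le> s ^ r" using cardW[OF y] by simp
  qed
  finally have "(\<Sum>x\<in>U. card {y\<in>U. x \<in> W y}) \<le> s ^ r * card U" by (simp add: mult.commute)
  moreover have "(\<Sum>x\<in>U. card (F x)) \<le> (\<Sum>x\<in>U. s ^ r + card {y\<in>U. x \<in> W y})"
    using key by (rule sum_mono)
  ultimately show ?thesis by (simp add: sum.distrib mult.commute)
qed

text \<open>The threshold is \<open>2 ^ r\<close> times the average bound \<open>2 * c r ^ r\<close>
  on fan sizes, so Markov's inequality leaves at most a fraction \<open>1 / 2 ^ r\<close> of bad
  vertices for each radius.\<close>

lemma exists_uniformly_good_vertex:
  assumes \<sigma>: "\<And>r. r \<ge> 1 \<Longrightarrow> linear_order_on (pverts G) (\<sigma> r)"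
    and c: "\<And>r x. r \<ge> 1 \<Longrightarrow> x \<in> pverts G \<Longrightarrow> card (S_reach r G (\<sigma> r) x) \<le> c r"
    and c1: "\<And>r. r \<ge> 1 \<Longrightarrow> c r \<ge> 1"
    and U: "U \<subseteq> pverts G" "U \<noteq> {}"
  shows "\<exists>x\<in>U. \<forall>r\<ge>1. \<forall>F. fan G r U x F \<longrightarrow> card F \<le> 2 ^ (r + 1) * c r ^ r"
proof (rule ccontr)
  assume "\<not> ?thesis"
  then have bad: "\<exists>r\<ge>1. \<exists>F. fan G r U x F \<and> card F > 2 ^ (r + 1) * c r ^ r" if "x \<in> U" for x
    using that by (meson not_le)
  define B where "B r = {x\<in>U. \<exists>F. fan G r U x F \<and> card F > 2 ^ (r + 1) * c r ^ r}" for r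
  have finU: "finite U" using finite_subset[OF U(1) pair_finite_verts] .
  have finB: "finite (B r)" for r using finU by (simp add: B_def)
  have cardB: "2 ^ r * card (B r) \<le> card U" if r: "r \<ge> 1" for r
  proof -
    have "\<forall>x\<in>B r. \<exists>F. fan G r U x F \<and> card F > 2 ^ (r + 1) * c r ^ r" by (simp add: B_def)
    from bchoice[OF this] obtain F0 where
      F0: "\<And>x. x \<in> B r \<Longrightarrow> fan G r U x (F0 x) \<and> card (F0 x) > 2 ^ (r + 1) * c r ^ r" by blast
    \<comment> \<open>Empty fans outside \<open>B r\<close> give a family on all of
      \<open>U\<close>, as the double count requires.\<close>
    define F where "F x = (if x \<in> B r then F0 x else {})" for x
    have F: "card (F x) > 2 ^ (r + 1) * c r ^ r" if "x \<in> B r" for x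
      using F0[OF that] that by (simp add: F_def)
    have fan: "fan G r U x (F x)" for x
    proof (cases "x \<in> B r")
      case True
      then show ?thesis using F0[OF True] by (simp add: F_def)
    qed (simp add: F_def fan_def)
    have "2 * c r ^ r * (2 ^ r * card (B r)) = (\<Sum>x\<in>B r. 2 ^ (r + 1) * c r ^ r)" by simp
    also have "\<dots> \<le> (\<Sum>x\<in>B r. card (F x))" using F by (intro sum_mono) (simp add: less_imp_le)
    also have "\<dots> \<le> (\<Sum>x\<in>U. card (F x))" using finU by (intro sum_mono2) (auto simp: B_def)
    also have "\<dots> \<le> 2 * c r ^ r * card U"
      by (rule sum_card_fans_le[OF \<sigma>[OF r] c[OF r] U(1) fan])
    finally show ?thesis using c1[OF r] by simp
  qed
  define n where "n = card U"
  \<comment> \<open>A bad fan has more than \<open>r\<close> walks but at most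
    \<open>card U\<close>, so only radii up to \<open>n\<close> occur.\<close>
  have "U \<subseteq> (\<Union>r\<in>{1..n}. B r)"
  proof
    fix x assume x: "x \<in> U"
    then obtain r F where r: "r \<ge> 1" and F: "fan G r U x F" "card F > 2 ^ (r + 1) * c r ^ r"
      using bad by blast
    have "r < 2 ^ r" by (rule less_exp)
    also have "(2::nat) ^ r \<le> 2 ^ (r + 1) * c r ^ r" using c1[OF r] by simp
    also have "\<dots> < card F" using F by simp
    also have "\<dots> \<le> n" using card_fan_le[OF F(1) finU] by (simp add: n_def)
    finally show "x \<in> (\<Union>r\<in>{1..n}. B r)" using x r F by (auto simp: B_def)
  qed
  then have "card U \<le> card (\<Union>r\<in>{1..n}. B r)" using finB by (intro card_mono) auto
  also have "\<dots> \<le> (\<Sum>r\<in>{1..n}. card (B r))" by (rule card_UN_le) simp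
  finally have "real (card U) \<le> (\<Sum>r\<in>{1..n}. real (card (B r)))"
    by (metis of_nat_le_iff of_nat_sum)
  also have "\<dots> \<le> (\<Sum>r\<in>{1..n}. real (card U) * (1 / 2) ^ r)"
  proof (rule sum_mono)
    fix r assume "r \<in> {1..n}"
    then have "2 ^ r * card (B r) \<le> card U" using cardB by simp
    then have "2 ^ r * real (card (B r)) \<le> real (card U)"
      by (metis of_nat_le_iff of_nat_mult of_nat_numeral of_nat_power)
    then show "real (card (B r)) \<le> real (card U) * (1 / 2) ^ r"
      by (simp add: field_simps power_divide)
  qed
  also have "\<dots> = real (card U) * (\<Sum>r\<in>{1..n}. (1 / 2) ^ r)" by (simp add: sum_distrib_left)
  \<comment> \<open>The finite sum falls short of 1 by \<open>(1 / 2) ^ n\<close>, which makes the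
    final inequality strict.\<close>
  also have "(\<Sum>r\<in>{1..n}. (1 / 2 :: real) ^ r) = 1 - (1 / 2) ^ n"
    by (induction n) auto
  also have "real (card U) * (1 - (1 / 2) ^ n) < real (card U)"
    using finU U(2) by (simp add: card_gt_0_iff algebra_simps)
  finally show False by simp
qed


section \<open>From small fans to few strongly reachable vertices\<close>

text \<open>In a breadth-first tree from \<open>x\<close>, keep only the branches leading to
  \<open>S_reach r G \<sigma> x\<close>. Fans bound the number of children by \<open>k\<close>, so
  depth \<open>i\<close> holds at most \<open>k ^ i\<close> vertices, and the depth is at most
  \<open>r\<close>.\<close>

lemma card_S_reach_le_sum_powers:
  assumes lin: "linear_order_on (pverts G) \<sigma>"
    and bound: "\<And>v F. v \<in> pverts G \<Longrightarrow> fan G r {y. (y, v) \<in> \<sigma>} v F \<Longrightarrow> card F \<le> k"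
    and x: "x \<in> pverts G"
  shows "card (S_reach r G \<sigma> x) \<le> (\<Sum>i\<le>r. k ^ i)"
proof -
  \<comment> \<open>Only vertices of \<open>A\<close> are expanded in \<open>L\<close>, so those
    below \<open>x\<close> are leaves, matching the exempt endpoint of a witness path.\<close>
  define A where "A = {v \<in> pverts G. (x, v) \<in> \<sigma>}"
  define L where "L n = ((\<lambda>X. parcs G `` (X \<inter> A)) ^^ n) {x}" for n
  define d where "d y = (LEAST n. y \<in> L n)" for y
  define M where "M = S_reach r G \<sigma> x"
  have L0: "L 0 = {x}" and LS: "\<And>n. L (Suc n) = parcs G `` (L n \<inter> A)" by (simp_all add: L_def)
  have dL: "y \<in> L (d y)" and d_le: "d y \<le> n" if "y \<in> L n" for y n
    using that unfolding d_def by (rule LeastI, rule Least_le)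
  \<comment> \<open>The last but one vertex \<open>v\<close> of a shortest such walk has depth
    exactly one less, since a shallower \<open>v\<close> would bring \<open>y\<close> closer. It
    serves as parent.\<close>
  have "\<forall>y\<in>{y. \<exists>i. y \<in> L (Suc i) \<and> d y = Suc i}.
      \<exists>v. v \<in> A \<and> (v, y) \<in> parcs G \<and> v \<in> L (d v) \<and> d y = Suc (d v)"
  proof safe
    fix y i assume y: "y \<in> L (Suc i)" "d y = Suc i"
    obtain v where v: "v \<in> L i" "v \<in> A" "(v, y) \<in> parcs G"
      using y(1) unfolding LS by blast
    have "y \<in> L (Suc (d v))" unfolding LS using dL[OF v(1)] v by blast
    then have "d y \<le> Suc (d v)" by (rule d_le)
    then have "d y = Suc (d v)" using d_le[OF v(1)] y(2) by simp
    then show "\<exists>v. v \<in> A \<and> (v, y) \<in> parcs G \<and> v \<in> L (d v) \<and> d y = Suc (d v)"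
      using v dL[OF v(1)] by blast
  qed
  from bchoice[OF this] obtain par where par':
    "\<And>y. y \<in> {y. \<exists>i. y \<in> L (Suc i) \<and> d y = Suc i} \<Longrightarrow>
      par y \<in> A \<and> (par y, y) \<in> parcs G \<and> par y \<in> L (d (par y)) \<and> d y = Suc (d (par y))"
    by blast
  have par: "par y \<in> A \<and> (par y, y) \<in> parcs G \<and> par y \<in> L i \<and> d (par y) = i"
    if "y \<in> L (Suc i)" "d y = Suc i" for y i
    using par'[of y] that by auto
  \<comment> \<open>the ancestor of \<open>y\<close> at depth \<open>j\<close> in the breadth-first tree rooted at \<open>x\<close>\<close>
  define anc where "anc y j = (par ^^ (d y - j)) y" for y j
  have anc_par: "anc y j = par (anc y (Suc j))" if "j < d y" for y j
  proof -
    have "d y - j = Suc (d y - Suc j)" using that by simp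
    then show ?thesis by (simp only: anc_def funpow.simps o_apply)
  qed
  have anc: "anc y j \<in> L j \<and> d (anc y j) = j" if "y \<in> L (d y)" "j \<le> d y" for y j
    using that(2)
  proof (induction j rule: inc_induct)
    case base
    then show ?case using that by (simp add: anc_def)
  next
    case (step j)
    then show ?case using par[of "anc y (Suc j)" j] anc_par[of j y] by simp
  qed
  have anc_arc: "anc y j \<in> A \<and> (anc y j, anc y (Suc j)) \<in> parcs G" if "y \<in> L (d y)" "j < d y" for y j
    using par[of "anc y (Suc j)" j] anc[OF that(1), of "Suc j"] anc_par[OF that(2)] that(2) by simp
  have anc_anc: "anc y i = (par ^^ (j - i)) (anc y j)" if "i \<le> j" "j \<le> d y" for y i j
  proof -
    have "d y - i = (j - i) + (d y - j)" using that by simp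
    then show ?thesis by (simp only: anc_def funpow_add o_apply)
  qed
  have M: "y \<in> L (d y) \<and> d y \<le> r \<and> (y, x) \<in> \<sigma>" if y: "y \<in> M" for y
  proof -
    from y obtain xs where xs: "successively (\<lambda>u v. (u, v) \<in> parcs G) (x # xs)" "length xs \<le> r"
      "last (x # xs) = y" "\<And>p. p \<in> set (butlast (x # xs)) \<Longrightarrow> (x, p) \<in> \<sigma>" "(y, x) \<in> \<sigma>"
      unfolding M_def by (rule S_reachE) blast
    \<comment> \<open>Walks grow on the right: the former end ceases to be exempt, so it is at least
      \<open>x\<close> and gets expanded.\<close>
    have "last (x # xs) \<in> L (length xs)" using xs(1,4)
    proof (induction xs rule: rev_induct)
      case Nil
      then show ?case by (simp add: L0)
    next
      case (snoc z zs)
      have s: "successively (\<lambda>u v. (u, v) \<in> parcs G) ((x # zs) @ [z])" using snoc.prems(1) by simp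
      then have s1: "successively (\<lambda>u v. (u, v) \<in> parcs G) (x # zs)" and e: "(last (x # zs), z) \<in> parcs G"
        by (simp_all only: successively_append_iff) simp_all
      have ge: "(x, p) \<in> \<sigma>" if "p \<in> set (x # zs)" for p
        using snoc.prems(2)[of p] that by (simp add: butlast_append)
      have "last (x # zs) \<in> L (length zs)"
        using snoc.IH[OF s1] ge in_set_butlastD by metis
      moreover have "last (x # zs) \<in> A"
        using ge[of "last (x # zs)"] e by (auto simp: A_def intro: wellformed')
      ultimately have "z \<in> L (Suc (length zs))" using e by (auto simp only: LS)
      then show ?case by simp
    qed
    then show ?thesis using dL d_le xs(2,3,5) le_trans by blast
  qed
  have finM: "finite M" using finite_subset[OF _ pair_finite_verts, of M] by (auto simp: M_def S_reach_def)
  \<comment> \<open>The tree is pruned to ancestors of \<open>M\<close>, so every vertex kept has a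
    descendant in \<open>M\<close> (possibly itself) where a branch can end.\<close>
  define N where "N i = (\<lambda>y. anc y i) ` {y \<in> M. i \<le> d y}" for i
  have finN: "finite (N i)" for i using finM by (simp add: N_def)
  have N: "c \<in> L i \<and> d c = i" if "c \<in> N i" for c i
    using that anc M by (auto simp: N_def)
  have children: "card {c \<in> N (Suc i). par c = v} \<le> k" if v: "v \<in> N i" for i v
  proof (cases "{c \<in> N (Suc i). par c = v} = {}")
    case True
    show ?thesis unfolding True by simp
  next
    case False
    let ?C = "{c \<in> N (Suc i). par c = v}"
    \<comment> \<open>A vertex with a child was expanded, hence is at least \<open>x\<close>;
      members of \<open>M\<close> are at most \<open>x\<close> and so at most
      \<open>v\<close>.\<close>
    from False have "v \<in> A" using N par by blast
    then have vV: "v \<in> pverts G" and xv: "(x, v) \<in> \<sigma>" by (auto simp: A_def)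
    have "\<forall>c\<in>?C. \<exists>y. y \<in> M \<and> Suc i \<le> d y \<and> c = anc y (Suc i)"
      by (auto simp: N_def)
    from bchoice[OF this] obtain Y
      where Y: "\<And>c. c \<in> ?C \<Longrightarrow> Y c \<in> M \<and> Suc i \<le> d (Y c) \<and> c = anc (Y c) (Suc i)"
      by blast
    \<comment> \<open>One branch per child \<open>c\<close>, from \<open>c\<close> down to a member
      of \<open>M\<close>; \<open>v\<close> itself is left out, as in the encoding of fans.\<close>
    define f where "f c = map (anc (Y c)) [Suc i..<Suc (d (Y c))]" for c
    have hd_f: "hd (f c) = c" if "c \<in> ?C" for c
      using Y[OF that] by (simp add: f_def hd_map del: upt_Suc)
    have in_f: "\<exists>j. Suc i \<le> j \<and> j \<le> d (Y c) \<and> w = anc (Y c) j" if "w \<in> set (f c)" for c w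
      using that by (auto simp: f_def simp del: upt_Suc)
    \<comment> \<open>Each vertex of a branch determines its ancestor \<open>c\<close> at depth
      \<open>Suc i\<close>, so branches through different children are disjoint.\<close>
    have recover: "c = (par ^^ (d w - Suc i)) w" if c: "c \<in> ?C" and w: "w \<in> set (f c)" for c w
    proof -
      obtain j where j: "Suc i \<le> j" "j \<le> d (Y c)" "w = anc (Y c) j" using in_f[OF w] by blast
      have "d w = j" using anc[of "Y c" j] M Y[OF c] j by auto
      then show ?thesis using anc_anc[OF j(1,2)] Y[OF c] j(3) by simp
    qed
    have "fan G r {y. (y, v) \<in> \<sigma>} v (f ` ?C)"
      unfolding fan_def
    proof (intro conjI ballI impI)
      fix P assume "P \<in> f ` ?C"
      then obtain c where c: "c \<in> ?C" and P: "P = f c" by blast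
      note Yc = Y[OF c]
      then have YL: "Y c \<in> L (d (Y c))" "d (Y c) \<le> r" "(Y c, x) \<in> \<sigma>" using M by auto
      show "P \<noteq> []" using Yc by (simp add: P f_def)
      show "length P \<le> r" using YL by (simp add: P f_def del: upt_Suc)
      have "last P = Y c" using Yc by (simp add: P f_def anc_def)
      then show "last P \<in> {y. (y, v) \<in> \<sigma>}"
        using YL(3) xv lin by (auto simp: order_on_defs dest: transD)
      have "v = anc (Y c) i" using c Yc anc_par[of i "Y c"] by auto
      then have "v # P = map (anc (Y c)) [i..<Suc (d (Y c))]"
        using Yc by (simp add: P f_def upt_conv_Cons del: upt_Suc)
      moreover have "successively (\<lambda>u v. (u, v) \<in> parcs G) (map (anc (Y c)) [i..<Suc (d (Y c))])"
        by (rule successively_map_upt) (use anc_arc[OF YL(1)] in simp)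
      ultimately show "successively (\<lambda>u v. (u, v) \<in> parcs G) (v # P)" by simp
    next
      fix P Q assume "P \<in> f ` ?C" "Q \<in> f ` ?C" "P \<noteq> Q"
      then show "set P \<inter> set Q = {}" using recover by blast
    qed
    then have "card (f ` ?C) \<le> k" by (rule bound[OF vV])
    moreover have "inj_on f ?C" using hd_f by (metis (lifting) inj_onI)
    ultimately show ?thesis by (simp add: card_image)
  qed
  have cardN: "card (N i) \<le> k ^ i" for i
  proof (induction i)
    case 0
    have "N 0 \<subseteq> {x}" using N L0 by blast
    then show ?case using card_mono[of "{x}" "N 0"] by simp
  next
    case (Suc i)
    have "par c \<in> N i" if "c \<in> N (Suc i)" for c
      using that by (auto simp: N_def anc_par[symmetric])
    then have "N (Suc i) \<subseteq> (\<Union>v\<in>N i. {c \<in> N (Suc i). par c = v})" by blast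
    then have "card (N (Suc i)) \<le> card (\<Union>v\<in>N i. {c \<in> N (Suc i). par c = v})"
      using finN by (intro card_mono) auto
    also have "\<dots> \<le> (\<Sum>v\<in>N i. card {c \<in> N (Suc i). par c = v})" by (rule card_UN_le[OF finN])
    also have "\<dots> \<le> (\<Sum>v\<in>N i. k)" by (rule sum_mono[OF children])
    also have "\<dots> \<le> k ^ Suc i" using Suc by simp
    finally show ?case .
  qed
  have "M \<subseteq> (\<Union>i\<in>{..r}. N i)"
  proof
    fix y assume y: "y \<in> M"
    have "y = anc y (d y)" by (simp add: anc_def)
    then have "y \<in> N (d y)" using y by (auto simp: N_def)
    then show "y \<in> (\<Union>i\<in>{..r}. N i)" using M[OF y] by blast
  qed
  then have "card M \<le> card (\<Union>i\<in>{..r}. N i)" using finN by (intro card_mono) auto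
  also have "\<dots> \<le> (\<Sum>i\<le>r. card (N i))" by (rule card_UN_le) simp
  also have "\<dots> \<le> (\<Sum>i\<le>r. k ^ i)" by (rule sum_mono[OF cardN])
  finally show ?thesis by (simp add: M_def)
qed

section \<open>Colouring numbers as minima, and the uniform ordering\<close>

lemma finite_orderings: "finite (orderings G)"
  by (rule finite_subset[of _ "Pow (pverts G \<times> pverts G)"])
    (auto simp: orderings_def order_on_defs pair_finite_verts)

text \<open>Without vertices both sides hold, by the default value 0.\<close>

lemma scol_ord_le_iff:
  "scol_ord r G \<sigma> \<le> n \<longleftrightarrow> (\<forall>x\<in>pverts G. card (S_reach r G \<sigma> x) \<le> n)"
  using pair_finite_verts by (auto simp: scol_ord_def)

text \<open>The minimum is attained: there are finitely many orderings, and one exists by the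
  well-ordering theorem.\<close>

lemma scol_le_iff: "scol r G \<le> n \<longleftrightarrow> (\<exists>\<sigma>\<in>orderings G. scol_ord r G \<sigma> \<le> n)"
proof -
  have "orderings G \<noteq> {}"
    using well_order_on[of "pverts G"] by (auto simp: orderings_def well_order_on_def)
  then show ?thesis unfolding scol_def using finite_orderings by (simp add: Min_le_iff)
qed

lemma exists_uniform_ordering:
  assumes c1: "\<And>r. r \<ge> 1 \<Longrightarrow> c r \<ge> 1" and c: "\<And>r. r \<ge> 1 \<Longrightarrow> scol r G \<le> c r"
  shows "\<exists>\<sigma>\<in>orderings G. \<forall>r\<ge>1. scol_ord r G \<sigma> \<le> (\<Sum>i\<le>r. (2 ^ (r + 1) * c r ^ r) ^ i)"
proof -
  \<comment> \<open>At this point each radius still has its own ordering.\<close>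
  have "\<forall>r. \<exists>\<sigma>. r \<ge> 1 \<longrightarrow> linear_order_on (pverts G) \<sigma> \<and> (\<forall>x\<in>pverts G. card (S_reach r G \<sigma> x) \<le> c r)"
    using c by (auto simp: scol_le_iff scol_ord_le_iff orderings_def)
  then obtain \<sigma> where \<sigma>: "\<And>r. r \<ge> 1 \<Longrightarrow> linear_order_on (pverts G) (\<sigma> r)"
    "\<And>r x. r \<ge> 1 \<Longrightarrow> x \<in> pverts G \<Longrightarrow> card (S_reach r G (\<sigma> r) x) \<le> c r" by metis
  define good where
    "good U x \<longleftrightarrow> (\<forall>r\<ge>1. \<forall>F. fan G r U x F \<longrightarrow> card F \<le> 2 ^ (r + 1) * c r ^ r)" for U x
  have "\<exists>x\<in>U. good U x" if "U \<subseteq> pverts G" "U \<noteq> {}" for U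
    unfolding good_def using \<sigma> c1 that by (rule exists_uniformly_good_vertex)
  from exists_ordering[OF pair_finite_verts this] obtain \<tau> where
    \<tau>: "linear_order_on (pverts G) \<tau>" "\<forall>x\<in>pverts G. good {y. (y, x) \<in> \<tau>} x" by blast
  show ?thesis
  proof (intro bexI[of _ \<tau>] allI impI)
    fix r :: nat assume r: "r \<ge> 1"
    show "scol_ord r G \<tau> \<le> (\<Sum>i\<le>r. (2 ^ (r + 1) * c r ^ r) ^ i)"
      unfolding scol_ord_le_iff
      by (intro ballI card_S_reach_le_sum_powers[OF \<tau>(1)]) (use \<tau>(2) r in \<open>simp_all add: good_def\<close>)
  qed (simp add: orderings_def \<tau>)
qed

end

theorem corollary1p5:
  fixes \<G> :: "'a pair_pre_digraph set"
  assumes "\<And>G. G \<in> \<G> \<Longrightarrow> pair_graph G"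
  shows "bounded_expansion \<G> \<longleftrightarrow>
    (\<exists>c :: nat \<Rightarrow> nat. (\<forall>r\<ge>1. c r \<ge> 1) \<and>
      (\<forall>G\<in>\<G>. \<exists>\<sigma> \<in> orderings G. \<forall>r\<ge>1. scol_ord r G \<sigma> \<le> c r))"
proof
  assume "bounded_expansion \<G>"
  then obtain c :: "nat \<Rightarrow> nat" where c: "\<And>r. r \<ge> 1 \<Longrightarrow> c r \<ge> 1"
    "\<And>r G. r \<ge> 1 \<Longrightarrow> G \<in> \<G> \<Longrightarrow> scol r G \<le> c r"
    unfolding bounded_expansion_def by blast
  define c' where "c' r = (\<Sum>i\<le>r. (2 ^ (r + 1) * c r ^ r) ^ i)" for r
  \<comment> \<open>The term for \<open>i = 0\<close> is 1, which keeps the bound positive.\<close>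
  have "c' r \<ge> 1" for r
    using member_le_sum[of 0 "{..r}" "\<lambda>i. (2 ^ (r + 1) * c r ^ r) ^ i"] by (simp add: c'_def)
  moreover have "\<exists>\<sigma>\<in>orderings G. \<forall>r\<ge>1. scol_ord r G \<sigma> \<le> c' r" if "G \<in> \<G>" for G
    unfolding c'_def by (rule pair_graph.exists_uniform_ordering[OF assms[OF that] c(1) c(2)[OF _ that]])
  ultimately show "\<exists>c :: nat \<Rightarrow> nat. (\<forall>r\<ge>1. c r \<ge> 1) \<and>
      (\<forall>G\<in>\<G>. \<exists>\<sigma> \<in> orderings G. \<forall>r\<ge>1. scol_ord r G \<sigma> \<le> c r)"
    by (intro exI[of _ c']) simp
next
  assume "\<exists>c :: nat \<Rightarrow> nat. (\<forall>r\<ge>1. c r \<ge> 1) \<and>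
      (\<forall>G\<in>\<G>. \<exists>\<sigma> \<in> orderings G. \<forall>r\<ge>1. scol_ord r G \<sigma> \<le> c r)"
  then obtain c :: "nat \<Rightarrow> nat" where c: "\<forall>r\<ge>1. c r \<ge> 1"
    "\<forall>G\<in>\<G>. \<exists>\<sigma> \<in> orderings G. \<forall>r\<ge>1. scol_ord r G \<sigma> \<le> c r" by (elim exE conjE)
  have "scol r G \<le> c r" if "r \<ge> 1" "G \<in> \<G>" for r G
  proof -
    from c(2) that obtain \<sigma> where "\<sigma> \<in> orderings G" "scol_ord r G \<sigma> \<le> c r" by blast
    then show ?thesis using pair_graph.scol_le_iff[OF assms[OF that(2)]] by blast
  qed
  with c(1) show "bounded_expansion \<G>" unfolding bounded_expansion_def by (intro exI[of _ c]) simp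
qed

end
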